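(* Let $l,m,n\in\mathbb{R}$, and let $\gamma(t)=(x^1(t),x^2(t),x^3(t),y^1(t),y^2(t),y^3(t))$ be a smooth curve in $TH_3$, defined on an open interval containing $0$, whose base curve $(x^1(t),x^2(t),x^3(t))$ in the Heisenberg manifold reduces to the origin point $(0,0,0)$ for all $t$, and such that $\gamma(0)=(0,0,0,0,0,0)$ and $\dot\gamma(0)=(0,0,0,l,m,n)$. Then $\gamma$ is a geodesic of $(TH_3,g^s)$ if and only if $\gamma(t)=(0,0,0,lt,mt,nt)$ for all $t$.
   Context: The Heisenberg manifold $(H_3,g)$ is $\mathbb{R}^3$ with coordinates $(x^1,x^2,x^3)$ and metric $g=(dx^1)^2+(dx^2)^2+(dx^3+x^2dx^1-x^1dx^2)^2$. The tangent bundle $TH_3$ has induced coordinates $(x^1,x^2,x^3,y^1,y^2,y^3)$, where $y^i$ are the components of a tangent vector $y^i\frac{\partial}{\partial x^i}$. Points of $TH_3$ and velocities of curves in $TH_3$ are written in these coordinates. The Sasaki metric on $TH_3$ is $$g^s=(dx^1)^2+(dx^2)^2+(dx^3+x^2dx^1-x^1dx^2)^2+(Dy^1)^2+(Dy^2)^2+(Dy^3+x^2Dy^1-x^1Dy^2)^2,$$ where $Dy^i=dy^i+\Gamma^i_{hj}y^h\,dx^j$ and $\Gamma^i_{hj}$ are the Christoffel symbols of $g$. *)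

theory Defs
  imports "HOL-Analysis.Analysis"
begin

text \<open>
  A (pseudo-)Riemannian metric in global coordinates on \<^typ>\<open>real^'n\<close> is given by its value
  \<open>g p v w\<close> on two tangent vectors \<open>v\<close>, \<open>w\<close> at \<open>p\<close>; all vectors are given by their components
  in the coordinate frame.
\<close>

type_synonym 'n metric = "real^'n \<Rightarrow> real^'n \<Rightarrow> real^'n \<Rightarrow> real"

definition metric_matrix :: "'n::finite metric \<Rightarrow> real^'n \<Rightarrow> real^'n^'n" where
  "metric_matrix g p = (\<chi> i j. g p (axis i 1) (axis j 1))"

definition partial_deriv :: "'n::finite \<Rightarrow> (real^'n \<Rightarrow> real) \<Rightarrow> real^'n \<Rightarrow> real" where
  "partial_deriv k f p = deriv (\<lambda>s. f (p + s *\<^sub>R axis k 1)) 0"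

text \<open>Christoffel symbols of the Levi-Civita connection; \<open>christoffel g i h j p\<close> has upper
  index \<open>i\<close> and lower indices \<open>h\<close>, \<open>j\<close>.\<close>

definition christoffel :: "'n::finite metric \<Rightarrow> 'n \<Rightarrow> 'n \<Rightarrow> 'n \<Rightarrow> real^'n \<Rightarrow> real" where
  "christoffel g i h j p =
     (1/2) * (\<Sum>k\<in>UNIV. matrix_inv (metric_matrix g p) $ i $ k *
        (partial_deriv h (\<lambda>q. metric_matrix g q $ k $ j) p
         + partial_deriv j (\<lambda>q. metric_matrix g q $ k $ h) p
         - partial_deriv k (\<lambda>q. metric_matrix g q $ h $ j) p))"

definition velocity :: "(real \<Rightarrow> 'a::real_normed_vector) \<Rightarrow> real \<Rightarrow> 'a" where
  "velocity c t = vector_derivative c (at t)"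

text \<open>The set \<open>I\<close> is meant to be open, so that derivatives at its points only depend on
  the curve on \<open>I\<close>.\<close>

definition smooth_curve_on :: "real set \<Rightarrow> (real \<Rightarrow> 'a::real_normed_vector) \<Rightarrow> bool" where
  "smooth_curve_on I c \<longleftrightarrow> (\<forall>k. \<forall>t\<in>I. (velocity ^^ k) c differentiable (at t))"

definition geodesic_on :: "'n::finite metric \<Rightarrow> real set \<Rightarrow> (real \<Rightarrow> real^'n) \<Rightarrow> bool" where
  "geodesic_on g I c \<longleftrightarrow> smooth_curve_on I c \<and>
     (\<forall>t\<in>I. \<forall>i. velocity (velocity c) t $ i
        + (\<Sum>h\<in>UNIV. \<Sum>j\<in>UNIV. christoffel g i h j (c t) * velocity c t $ h * velocity c t $ j) = 0)"

text \<open>Polarization of \<open>(dx\<^sup>1)\<^sup>2 + (dx\<^sup>2)\<^sup>2 + (dx\<^sup>3 + x\<^sup>2 dx\<^sup>1 - x\<^sup>1 dx\<^sup>2)\<^sup>2\<close>.\<close>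

definition heisenberg_metric :: "3 metric" where
  "heisenberg_metric x v w =
     v$1 * w$1 + v$2 * w$2
     + (v$3 + x$2 * v$1 - x$1 * v$2) * (w$3 + x$2 * w$1 - x$1 * w$2)"

text \<open>
  Induced coordinates on the tangent bundle are indexed by the sum type \<open>'n + 'n\<close>: index
  \<open>Inl i\<close> stands for \<open>x\<^sup>i\<close> and index \<open>Inr i\<close> for \<open>y\<^sup>i\<close>.
\<close>

definition tb_pair :: "real^'n \<Rightarrow> real^'n \<Rightarrow> real^('n::finite + 'n)" where
  "tb_pair x y = (\<chi> k. case k of Inl i \<Rightarrow> x $ i | Inr i \<Rightarrow> y $ i)"

definition tb_base :: "real^('n::finite + 'n) \<Rightarrow> real^'n" where
  "tb_base p = (\<chi> i. p $ Inl i)"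

definition tb_fibre :: "real^('n::finite + 'n) \<Rightarrow> real^'n" where
  "tb_fibre p = (\<chi> i. p $ Inr i)"

text \<open>\<open>Dy\<^sup>i = dy\<^sup>i + \<Gamma>\<^sup>i\<^sub>h\<^sub>j y\<^sup>h dx\<^sup>j\<close> at the point \<open>p = (x, y)\<close>, applied to the tangent vector \<open>v\<close>.\<close>

definition cov_Dy :: "'n::finite metric \<Rightarrow> real^('n + 'n) \<Rightarrow> real^('n + 'n) \<Rightarrow> real^'n" where
  "cov_Dy g p v = (\<chi> i. tb_fibre v $ i
     + (\<Sum>h\<in>UNIV. \<Sum>j\<in>UNIV. christoffel g i h j (tb_base p) * tb_fibre p $ h * tb_base v $ j))"

text \<open>\<open>g\<^sup>s = g\<^sub>i\<^sub>j dx\<^sup>i dx\<^sup>j + g\<^sub>i\<^sub>j Dy\<^sup>i Dy\<^sup>j\<close>.\<close>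

definition sasaki_metric :: "'n::finite metric \<Rightarrow> ('n + 'n) metric" where
  "sasaki_metric g p v w =
     g (tb_base p) (tb_base v) (tb_base w) + g (tb_base p) (cov_Dy g p v) (cov_Dy g p w)"

end

theory Submission
  imports Defs
begin

text \<open>
  In a Sasaki metric the Christoffel symbols with two vertical lower indices vanish: the lowered
  symbol with first index horizontal is half of \<open>\<Gamma>\<^sub>b\<^sub>,\<^sub>a\<^sub>c + \<Gamma>\<^sub>a\<^sub>,\<^sub>b\<^sub>c - \<partial>\<^sub>c g\<^sub>a\<^sub>b\<close>, which is zero
  because the connection is metric. Hence a curve inside a fibre is a geodesic exactly when its
  second coordinate derivative is zero. Lowering indices avoids inverting the Sasaki metric.
\<close>

section \<open>Coordinate vectors of the tangent bundle\<close>

lemma scaleR_tb_pair: "r *\<^sub>R tb_pair x y = tb_pair (r *\<^sub>R x) (r *\<^sub>R y)"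
  by (auto simp: tb_pair_def vec_eq_iff split: sum.split)

lemma axis_nth_if: "axis i r $ j = (if j = i then r else 0)"
  by (simp add: axis_def)

lemma tb_base_axis_Inr [simp]: "tb_base (axis (Inr a) r) = 0"
  by (simp add: tb_base_def vec_eq_iff axis_def)

lemma tb_base_axis_Inl [simp]: "tb_base (axis (Inl a) r) = axis a r"
  by (simp add: tb_base_def vec_eq_iff axis_def)

lemma tb_fibre_axis_Inr [simp]: "tb_fibre (axis (Inr a) r) = axis a r"
  by (simp add: tb_fibre_def vec_eq_iff axis_def)

lemma tb_fibre_axis_Inl [simp]: "tb_fibre (axis (Inl a) r) = 0"
  by (simp add: tb_fibre_def vec_eq_iff axis_def)

lemma tb_base_add_scaleR: "tb_base (p + r *\<^sub>R q) = tb_base p + r *\<^sub>R tb_base q"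
  by (simp add: tb_base_def vec_eq_iff)

lemma tb_fibre_add_scaleR: "tb_fibre (p + r *\<^sub>R q) = tb_fibre p + r *\<^sub>R tb_fibre q"
  by (simp add: tb_fibre_def vec_eq_iff)

lemma cov_Dy_axis_Inr: "cov_Dy g p (axis (Inr b) 1) = axis b 1"
  by (simp add: cov_Dy_def vec_eq_iff)

text \<open>Over a fixed base point the right-hand side is linear in the fibre coordinates; this
  makes the mixed Sasaki components affine along each fibre.\<close>

lemma cov_Dy_axis_Inl:
  "cov_Dy g p (axis (Inl c) 1)
     = (\<chi> i. \<Sum>h\<in>UNIV. christoffel g i h c (tb_base p) * tb_fibre p $ h)"
  by (simp add: cov_Dy_def vec_eq_iff axis_nth_if if_distrib cong: if_cong)

section \<open>Christoffel symbols, with lowered index and on the fibres\<close>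

lemma partial_deriv_affine:
  assumes "\<And>s. f (p + s *\<^sub>R axis k 1) = A + s * B"
  shows "partial_deriv k f p = B"
  unfolding partial_deriv_def assms
  by (rule DERIV_imp_deriv) (auto intro!: derivative_eq_intros)

lemma linear_eq_sum_axis:
  fixes f :: "real^'n::finite \<Rightarrow> real"
  assumes "linear f"
  shows "f v = (\<Sum>i\<in>UNIV. v $ i * f (axis i 1))"
proof -
  have "f v = f (\<Sum>i\<in>UNIV. v $ i *\<^sub>R axis i 1)"
    using basis_expansion[of v] by (simp add: scalar_mult_eq_scaleR)
  then show ?thesis
    by (simp add: linear_sum[OF assms] linear_scale[OF assms])
qed

text \<open>Multiplying by the metric matrix cancels the inverse in \<open>christoffel\<close>,
  leaving the symbols of the first kind.\<close>

lemma christoffel_lower: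
  fixes g :: "'n::finite metric"
  assumes bil: "bilinear (g x)" and sym: "\<And>v w. g x v w = g x w v"
    and inv: "invertible (metric_matrix g x)"
  shows "g x (\<chi> i. christoffel g i h j x) (axis b 1) =
    (1/2) * (partial_deriv h (\<lambda>q. metric_matrix g q $ b $ j) x
         + partial_deriv j (\<lambda>q. metric_matrix g q $ b $ h) x
         - partial_deriv b (\<lambda>q. metric_matrix g q $ h $ j) x)"
proof -
  define T where "T k = partial_deriv h (\<lambda>q. metric_matrix g q $ k $ j) x
         + partial_deriv j (\<lambda>q. metric_matrix g q $ k $ h) x
         - partial_deriv k (\<lambda>q. metric_matrix g q $ h $ j) x" for k
  let ?M = "metric_matrix g x"
  \<comment> \<open>\<open>matrix_inv\<close> is a Hilbert choice; invertibility makes the chosen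
    matrix a genuine inverse.\<close>
  have MI: "?M ** matrix_inv ?M = mat 1"
    using someI_ex[OF inv[unfolded invertible_def]] by (simp add: matrix_inv_def)
  have lin: "linear (\<lambda>v. g x v (axis b 1))"
    using bil by (simp add: bilinear_def)
  have "(\<chi> i. christoffel g i h j x) = matrix_inv ?M *v ((1/2) *\<^sub>R (\<chi> k. T k))"
    by (simp add: christoffel_def T_def vec_eq_iff matrix_vector_mult_def sum_divide_distrib)
  then have "?M *v (\<chi> i. christoffel g i h j x) = (1/2) *\<^sub>R (\<chi> k. T k)"
    by (simp only: matrix_vector_mul_assoc MI matrix_vector_mul_lid)
  then have "(?M *v (\<chi> i. christoffel g i h j x)) $ b = (1/2) * T b"
    by simp
  moreover have "(?M *v (\<chi> i. christoffel g i h j x)) $ b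
      = g x (\<chi> i. christoffel g i h j x) (axis b 1)"
    using linear_eq_sum_axis[OF lin, of "\<chi> i. christoffel g i h j x"]
    by (simp add: matrix_vector_mult_def metric_matrix_def sym[of "axis b 1"] mult.commute)
  ultimately show ?thesis
    by (simp add: T_def)
qed

lemma christoffel_sasaki_vertical:
  fixes g :: "'n::finite metric"
  assumes bil: "\<And>x. bilinear (g x)" and sym: "\<And>x v w. g x v w = g x w v"
    and inv: "invertible (metric_matrix g (tb_base p))"
  shows "christoffel (sasaki_metric g) i (Inr a) (Inr b) p = 0"
proof -
  let ?G = "metric_matrix (sasaki_metric g)"
  let ?x = "tb_base p"
  have lin: "linear (\<lambda>v. g x v w)" for x w
    using bil by (simp add: bilinear_def)
  note [simp] = bilinear_lzero[OF bil] bilinear_rzero[OF bil]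
  have GVV: "?G q $ Inr c $ Inr d = metric_matrix g (tb_base q) $ c $ d" for q c d
    by (simp add: metric_matrix_def sasaki_metric_def cov_Dy_axis_Inr)
  have GHV: "?G q $ Inl c $ Inr d = g (tb_base q) (cov_Dy g q (axis (Inl c) 1)) (axis d 1)" for q c d
    by (simp add: metric_matrix_def sasaki_metric_def cov_Dy_axis_Inr)
  have base: "tb_base (p + s *\<^sub>R axis (Inr c) 1) = ?x" for s c
    by (simp add: tb_base_add_scaleR)
  have dV_VV: "partial_deriv (Inr e) (\<lambda>q. ?G q $ Inr c $ Inr d) p = 0" for c d e
    by (rule partial_deriv_affine[where A = "?G p $ Inr c $ Inr d"]) (simp add: GVV base)
  \<comment> \<open>A horizontal coordinate line projects to a coordinate line of the base, so both
    sides differentiate the same real function.\<close>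
  have dH_VV: "partial_deriv (Inl e) (\<lambda>q. ?G q $ Inr c $ Inr d) p
      = partial_deriv e (\<lambda>q. metric_matrix g q $ c $ d) ?x" for c d e
    by (simp add: partial_deriv_def GVV tb_base_add_scaleR)
  \<comment> \<open>Raising the fibre coordinate \<open>e\<close> by \<open>s\<close> adds
    \<open>s\<close> times the vector of symbols with lower indices \<open>e\<close>,
    \<open>c\<close>; the slope is that vector paired with \<open>axis d 1\<close>.\<close>
  have dV_HV: "partial_deriv (Inr e) (\<lambda>q. ?G q $ Inl c $ Inr d) p
      = g ?x (\<chi> i. christoffel g i e c ?x) (axis d 1)" for c d e
  proof (rule partial_deriv_affine[where A = "?G p $ Inl c $ Inr d"])
    fix s
    have "cov_Dy g (p + s *\<^sub>R axis (Inr e) 1) (axis (Inl c) 1)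
        = cov_Dy g p (axis (Inl c) 1) + s *\<^sub>R (\<chi> i. christoffel g i e c ?x)"
      by (simp add: cov_Dy_axis_Inl base tb_fibre_add_scaleR vec_eq_iff distrib_left
            sum.distrib axis_nth_if if_distrib[of "(*) _"] mult.commute[of s] cong: if_cong)
    then show "?G (p + s *\<^sub>R axis (Inr e) 1) $ Inl c $ Inr d
        = ?G p $ Inl c $ Inr d + s * g ?x (\<chi> i. christoffel g i e c ?x) (axis d 1)"
      by (simp add: GHV base linear_add[OF lin] linear_scale[OF lin])
  qed
  have sym_matrix: "metric_matrix g q $ c $ d = metric_matrix g q $ d $ c" for q c d
    by (simp add: metric_matrix_def sym[of q "axis c 1"])
  \<comment> \<open>This bracket is the factor next to the inverse Sasaki matrix in
    \<open>christoffel\<close>, so its vanishing for every \<open>k\<close> settles the claim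
    whatever that matrix is.\<close>
  have "partial_deriv (Inr a) (\<lambda>q. ?G q $ k $ Inr b) p
      + partial_deriv (Inr b) (\<lambda>q. ?G q $ k $ Inr a) p
      - partial_deriv k (\<lambda>q. ?G q $ Inr a $ Inr b) p = 0" for k
  proof (cases k)
    case (Inl c)
    \<comment> \<open>Metric compatibility: the derivatives in directions \<open>a\<close> and
      \<open>b\<close> cancel, and the two halves of the derivative in direction \<open>c\<close>
      add up.\<close>
    have "g ?x (\<chi> i. christoffel g i a c ?x) (axis b 1)
        + g ?x (\<chi> i. christoffel g i b c ?x) (axis a 1)
        = partial_deriv c (\<lambda>q. metric_matrix g q $ a $ b) ?x"
      unfolding christoffel_lower[OF bil sym inv]
      by (simp add: sym_matrix[of _ b a] field_simps)
    then show ?thesis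
      by (simp add: Inl dH_VV dV_HV)
  next
    case (Inr c)
    then show ?thesis
      by (simp add: dV_VV)
  qed
  then show ?thesis
    unfolding christoffel_def by (simp del: mult_eq_0_iff)
qed

section \<open>The Heisenberg metric\<close>

lemma bilinear_heisenberg_metric: "bilinear (heisenberg_metric x)"
  unfolding bilinear_def heisenberg_metric_def
  by (auto intro!: linearI simp: algebra_simps)

lemma heisenberg_metric_sym: "heisenberg_metric x v w = heisenberg_metric x w v"
  by (simp add: heisenberg_metric_def algebra_simps)

lemma metric_matrix_heisenberg_origin: "metric_matrix heisenberg_metric 0 = mat 1"
  by (simp add: metric_matrix_def heisenberg_metric_def mat_def vec_eq_iff forall_3 axis_def)

section \<open>Velocity and acceleration of smooth curves\<close>

lemma smooth_curve_on_has_vector_derivative: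
  assumes "smooth_curve_on I c" "t \<in> I"
  shows "((velocity ^^ k) c has_vector_derivative (velocity ^^ Suc k) c t) (at t)"
  using assms unfolding smooth_curve_on_def
  by (simp add: velocity_def vector_derivative_works)

lemma velocity_Inl_eq_0:
  assumes "open I" "smooth_curve_on I c" and base: "\<And>t. t \<in> I \<Longrightarrow> tb_base (c t) = x" and "t \<in> I"
  shows "velocity c t $ Inl i = 0"
proof -
  have "((\<lambda>t. c t $ Inl i) has_vector_derivative velocity c t $ Inl i) (at t)"
    using smooth_curve_on_has_vector_derivative[OF assms(2,4), of 0]
    by (auto intro: bounded_linear.has_vector_derivative)
  moreover have "((\<lambda>t. c t $ Inl i) has_vector_derivative 0) (at t)"
  proof (rule has_vector_derivative_transform_within_open[OF _ assms(1,4)])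
    show "((\<lambda>t. x $ i) has_vector_derivative 0) (at t)"
      by simp
    show "x $ i = c s $ Inl i" if "s \<in> I" for s
      using base[OF that] by (auto simp: tb_base_def)
  qed
  ultimately show ?thesis
    by (rule vector_derivative_unique_at)
qed

text \<open>A function with zero derivative on an interval is constant; applied twice, this
  integrates the equation. Conversely, since \<open>I\<close> is open, derivatives at its points can
  be computed from the affine formula, which holds only there.\<close>

lemma acceleration_zero_iff_affine:
  fixes c :: "real \<Rightarrow> 'a::real_normed_vector"
  assumes "open I" "is_interval I" "0 \<in> I" "smooth_curve_on I c"
  shows "(\<forall>t\<in>I. velocity (velocity c) t = 0) \<longleftrightarrow> (\<forall>t\<in>I. c t = c 0 + t *\<^sub>R velocity c 0)"
proof
  note der0 = smooth_curve_on_has_vector_derivative[OF assms(4), of _ 0, simplified]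
  note der1 = smooth_curve_on_has_vector_derivative[OF assms(4), of _ 1, simplified]
  have conv: "convex I"
    using assms(2) by (rule is_interval_convex)
  assume acc: "\<forall>t\<in>I. velocity (velocity c) t = 0"
  have "(velocity c has_vector_derivative 0) (at t within I)" if "t \<in> I" for t
    using der1[OF that] acc that by (auto intro: has_vector_derivative_at_within)
  then obtain v where "\<And>t. t \<in> I \<Longrightarrow> velocity c t = v"
    using has_vector_derivative_zero_constant[OF conv, of "velocity c"] by blast
  then have vel: "velocity c t = velocity c 0" if "t \<in> I" for t
    using assms(3) that by metis
  \<comment> \<open>Subtracting the linear part gives a second function with zero derivative; its
    constant value is read off at 0.\<close>
  have "((\<lambda>t. c t - t *\<^sub>R velocity c 0) has_vector_derivative 0) (at t within I)" if "t \<in> I" for t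
    using der0[OF that] vel[OF that]
    by (auto intro!: derivative_eq_intros intro: has_vector_derivative_at_within)
  then obtain u where u: "\<And>t. t \<in> I \<Longrightarrow> c t - t *\<^sub>R velocity c 0 = u"
    using has_vector_derivative_zero_constant[OF conv, of "\<lambda>t. c t - t *\<^sub>R velocity c 0"] by blast
  have "u = c 0"
    using u[OF assms(3)] by simp
  with u show "\<forall>t\<in>I. c t = c 0 + t *\<^sub>R velocity c 0"
    by (auto simp: diff_eq_eq)
next
  assume aff: "\<forall>t\<in>I. c t = c 0 + t *\<^sub>R velocity c 0"
  have vel: "velocity c t = velocity c 0" if "t \<in> I" for t
  proof -
    have "(c has_vector_derivative velocity c 0) (at t)"
    proof (rule has_vector_derivative_transform_within_open[OF _ assms(1) that])
      show "((\<lambda>t. c 0 + t *\<^sub>R velocity c 0) has_vector_derivative velocity c 0) (at t)"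
        by (auto intro!: derivative_eq_intros)
    qed (use aff in auto)
    then show ?thesis
      unfolding velocity_def[of c t] by (rule vector_derivative_at)
  qed
  show "\<forall>t\<in>I. velocity (velocity c) t = 0"
  proof
    fix t assume t: "t \<in> I"
    have "(velocity c has_vector_derivative 0) (at t)"
      by (rule has_vector_derivative_transform_within_open
            [OF has_vector_derivative_const assms(1) t vel[symmetric]])
    then show "velocity (velocity c) t = 0"
      unfolding velocity_def[of "velocity c" t] by (rule vector_derivative_at)
  qed
qed

section \<open>Geodesics inside a fibre\<close>

lemma geodesic_on_sasaki_fibre_iff:
  fixes g :: "'n::finite metric"
  assumes bil: "\<And>x. bilinear (g x)" and sym: "\<And>x v w. g x v w = g x w v"
    and inv: "invertible (metric_matrix g x)"
    and "open I" and smooth: "smooth_curve_on I c" and base: "\<And>t. t \<in> I \<Longrightarrow> tb_base (c t) = x"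
  shows "geodesic_on (sasaki_metric g) I c \<longleftrightarrow> (\<forall>t\<in>I. velocity (velocity c) t = 0)"
proof -
  \<comment> \<open>The quadratic part of the geodesic equation vanishes term by term: two vertical
    indices kill the symbol, and a horizontal index kills a velocity factor because the base point
    is fixed.\<close>
  have "christoffel (sasaki_metric g) i h j (c t) * velocity c t $ h * velocity c t $ j = 0"
    if "t \<in> I" for t i h j
  proof (cases h; cases j)
    fix a b assume "h = Inr a" "j = Inr b"
    then show ?thesis
      using inv by (simp add: christoffel_sasaki_vertical[OF bil sym] base[OF that])
  qed (simp_all add: velocity_Inl_eq_0[OF \<open>open I\<close> smooth base that])
  then show ?thesis
    using smooth by (simp add: geodesic_on_def vec_eq_iff sum.neutral del: mult_eq_0_iff)
qed

theorem theorem4p4: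
  fixes l m n :: real
    and I :: "real set"
    and \<gamma> :: "real \<Rightarrow> real^(3 + 3)"
  assumes "open I" and "is_interval I" and "0 \<in> I"
    and "smooth_curve_on I \<gamma>"
    and "\<forall>t\<in>I. tb_base (\<gamma> t) = vector [0, 0, 0]"
    and "\<gamma> 0 = tb_pair (vector [0, 0, 0]) (vector [0, 0, 0])"
    and "velocity \<gamma> 0 = tb_pair (vector [0, 0, 0]) (vector [l, m, n])"
  shows "geodesic_on (sasaki_metric heisenberg_metric) I \<gamma> \<longleftrightarrow>
    (\<forall>t\<in>I. \<gamma> t = tb_pair (vector [0, 0, 0]) (vector [l * t, m * t, n * t]))"
proof -
  have origin: "vector [0, 0, 0] = (0 :: real^3)"
    by (simp add: vec_eq_iff forall_3)
  \<comment> \<open>At the origin the coordinate frame is orthonormal, so the metric matrix is the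
    identity and its own inverse.\<close>
  have "invertible (metric_matrix heisenberg_metric 0)"
    unfolding metric_matrix_heisenberg_origin invertible_def
    by (intro exI[of _ "mat 1"]) simp
  then have "geodesic_on (sasaki_metric heisenberg_metric) I \<gamma>
      \<longleftrightarrow> (\<forall>t\<in>I. velocity (velocity \<gamma>) t = 0)"
    using assms(1,4,5) origin
    by (intro geodesic_on_sasaki_fibre_iff[where x = 0] bilinear_heisenberg_metric
          heisenberg_metric_sym) auto
  also have "\<dots> \<longleftrightarrow> (\<forall>t\<in>I. \<gamma> t = \<gamma> 0 + t *\<^sub>R velocity \<gamma> 0)"
    by (rule acceleration_zero_iff_affine[OF assms(1-4)])
  finally have iff: "geodesic_on (sasaki_metric heisenberg_metric) I \<gamma>
      \<longleftrightarrow> (\<forall>t\<in>I. \<gamma> t = \<gamma> 0 + t *\<^sub>R velocity \<gamma> 0)" .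
  \<comment> \<open>The initial data turn the general affine curve into the stated line through the
    zero vector.\<close>
  have "\<gamma> 0 + t *\<^sub>R velocity \<gamma> 0
      = tb_pair (vector [0, 0, 0]) (vector [l * t, m * t, n * t])" for t
  proof -
    have "\<gamma> 0 = 0"
      using assms(6) by (auto simp: origin tb_pair_def vec_eq_iff split: sum.split)
    moreover have "t *\<^sub>R vector [l, m, n] = (vector [l * t, m * t, n * t] :: real^3)"
      by (simp add: vec_eq_iff forall_3)
    ultimately show ?thesis
      by (simp add: assms(7) scaleR_tb_pair origin)
  qed
  with iff show ?thesis
    by simp
qed

end
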